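(* Let $\Phi$ be a metric space endowed with a metric $d$ and $T$ be an arbitrary set. Suppose that we are in one of the two following cases: (C-1) $T$ is a finite set; in this case set $\mathcal D=\Phi^T$ endowed with the product topology; (C-2) $\Phi=\mathbb{R}^p$ with $p\ge1$, $d$ being the Euclidean metric; in this case set $\mathcal D=\ell^\infty(T,\mathbb{R}^p)$. Let $\{\mathbb{L}_n(\phi,t),\ \phi\in\Phi,\ t\in T\}$ be a sequence of real-valued processes, $\{\mathbb{L}(\phi,t),\ \phi\in\Phi,\ t\in T\}$ be a real-valued process, $\{\widehat u(t),\ t\in T\}$ be a $\Phi$-valued process, and $\{\widehat u_n(t),\ t\in T\}$ be a sequence of $\Phi$-valued processes. Assume that (i) for any compact set $K\subset\Phi$, $\mathbb{L}_n\rightsquigarrow\mathbb{L}$ in $\ell^\infty(K\times T)$ and $\mathbb{L}$ is a tight Borel map taking values in $\ell^\infty(K\times T)$; (ii) for any $\eta>0$ and compact $K\subset\Phi$, we have almost surely that $$\inf_{t\in T}\Big[\inf\{\mathbb{L}(\phi,t):\phi\in K,\ d(\phi,\widehat u(t))\ge\eta\}-\mathbb{L}(\widehat u(t),t)\Big]>0;$$ (iii) for any $\epsilon>0$, there exists a compact $K\subset\Phi$ such that $P(\widehat u(t)\in K\text{ for all }t\in T)\ge1-\epsilon$; (iv) for any $\epsilon>0$, there exists a compact $K\subset\Phi$ such that $\liminf_{n} P_*(\widehat u_n(t)\in K\text{ for all }t\in T)\ge1-\epsilon$; (v) $\widehat u_n$ is approximately minimizing $\mathbb{L}_n$: $$\sup_{t\in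 T}\Big\{\mathbb{L}_n(\widehat u_n(t),t)-\inf_{\phi\in\Phi}\mathbb{L}_n(\phi,t)\Big\}_+=o_{P^*}(1).$$ Then there is a version of $\widehat u$ in $\mathcal D$ and $\widehat u_n\rightsquigarrow\widehat u$ (in $\mathcal D$).
   Context: All processes are defined on a probability space $(\Omega,\mathcal F,P)$. For $A\subseteq\Omega$, the outer probability is $P^*(A)=\inf\{P(B):B\in\mathcal F,\ A\subset B\}$ and the inner probability is $P_*(A)=1-P^*(A^c)$. The outer expectation of a real-valued map $Z$ on $\Omega$ is $E^*[Z]=\inf\{E[V]:V\ge Z,\ V\text{ measurable}\}$. For a sequence of real-valued maps $Y_n$ on $\Omega$, $Y_n=o_{P^*}(1)$ means $P^*(|Y_n|\ge\epsilon)\to0$ for every $\epsilon>0$. $a_+=\max(0,a)$. For a set $S$, $\ell^\infty(S,\mathbb{R}^p)$ is the normed space of bounded functions $f=(f_1,\dots,f_p):S\to\mathbb{R}^p$ with norm $\|f\|_S=\sup_{s\in S,\,i}|f_i(s)|$; $\ell^\infty(S)=\ell^\infty(S,\mathbb{R})$. In (i), $\mathbb{L}_n$ and $\mathbb{L}$ are restricted to $K\times T$. Weak convergence (Hoffmann-Jørgensen): for a metric space $\mathcal D$, a sequence of $\mathcal D$-valued maps $X_n$ on $\Omega$ (not necessarily measurable) converges weakly to $X$, denoted $X_n\rightsquigarrow X$, if $X$ is a Borel map and $E^*[f(X_n)]\to E[f(X)]$ for every bounded continuous $f:\mathcal D\to\mathbb{R}$. *)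

theory Defs
  imports "HOL-Probability.Probability"
begin

section \<open>Outer probability and outer expectation\<close>

definition outer_prob :: "'w measure \<Rightarrow> 'w set \<Rightarrow> real" where
  "outer_prob M A = (INF B \<in> {B \<in> sets M. A \<subseteq> B}. measure M B)"

definition inner_prob :: "'w measure \<Rightarrow> 'w set \<Rightarrow> real" where
  "inner_prob M A = 1 - outer_prob M (space M - A)"

text \<open>
  The majorants are required to be integrable because the Bochner integral of a non-integrable
  function is 0 by convention. This does not change the infimum: majorants of expectation
  \<open>\<infinity>\<close> are irrelevant to it (the infimum over no majorant is \<open>\<infinity>\<close>), and a majorant \<open>V\<close> of
  expectation \<open>-\<infinity>\<close> yields the integrable majorants \<open>max V (-k)\<close>, whose expectations tend to
  \<open>-\<infinity>\<close>.
\<close>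

definition outer_expectation :: "'w measure \<Rightarrow> ('w \<Rightarrow> real) \<Rightarrow> ereal" where
  "outer_expectation M Z =
     (INF V \<in> {V. integrable M V \<and> (\<forall>\<omega> \<in> space M. Z \<omega> \<le> V \<omega>)}. ereal (integral\<^sup>L M V))"

text \<open>
  Stated for maps into \<open>[0,\<infinity>]\<close>, because the suprema to which it is applied may be infinite.
\<close>

definition small_o_outer_prob :: "'w measure \<Rightarrow> (nat \<Rightarrow> 'w \<Rightarrow> ennreal) \<Rightarrow> bool" where
  "small_o_outer_prob M Y \<longleftrightarrow>
     (\<forall>\<epsilon>::real. \<epsilon> > 0 \<longrightarrow> (\<lambda>n. outer_prob M {\<omega> \<in> space M. Y n \<omega> \<ge> ennreal \<epsilon>}) \<longlonglongrightarrow> 0)"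


section \<open>Weak convergence\<close>

text \<open>
  Only the topology of the metric space enters these notions, so they take a
  \<^typ>\<open>'d topology\<close>.
\<close>

definition borel_sigma :: "'d topology \<Rightarrow> 'd measure" where
  "borel_sigma D = sigma (topspace D) {U. openin D U}"

definition weak_conv_HJ ::
  "'w measure \<Rightarrow> 'd topology \<Rightarrow> (nat \<Rightarrow> 'w \<Rightarrow> 'd) \<Rightarrow> ('w \<Rightarrow> 'd) \<Rightarrow> bool" where
  "weak_conv_HJ M D Xs X \<longleftrightarrow>
     (\<forall>n. Xs n \<in> space M \<rightarrow> topspace D) \<and>
     X \<in> M \<rightarrow>\<^sub>M borel_sigma D \<and>
     (\<forall>f. continuous_map D euclideanreal f \<and> bounded (f ` topspace D) \<longrightarrow>
        (\<lambda>n. outer_expectation M (\<lambda>\<omega>. f (Xs n \<omega>))) \<longlonglongrightarrow> ereal (integral\<^sup>L M (\<lambda>\<omega>. f (X \<omega>))))"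

definition tight_borel_map :: "'w measure \<Rightarrow> 'd topology \<Rightarrow> ('w \<Rightarrow> 'd) \<Rightarrow> bool" where
  "tight_borel_map M D X \<longleftrightarrow>
     X \<in> M \<rightarrow>\<^sub>M borel_sigma D \<and>
     (\<forall>\<epsilon>>0. \<exists>C. compactin D C \<and> measure M {\<omega> \<in> space M. X \<omega> \<in> C} \<ge> 1 - \<epsilon>)"


section \<open>Function spaces\<close>

text \<open>
  On \<open>\<real>\<^sup>p\<close>, \<^const>\<open>infnorm\<close> is the largest absolute value of a coordinate, and on \<open>\<real>\<close> it is the
  absolute value.
\<close>

definition infnorm_metric :: "'b::euclidean_space metric" where
  "infnorm_metric = metric (UNIV, \<lambda>x y. infnorm (x - y))"

lemma Metric_space_infnorm: "Metric_space UNIV (\<lambda>x y::'b::euclidean_space. infnorm (x - y))"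
proof
  fix x y z :: 'b
  show "0 \<le> infnorm (x - y)" by (rule infnorm_pos_le)
  show "infnorm (x - y) = infnorm (y - x)" by (rule infnorm_sub)
  show "infnorm (x - y) = 0 \<longleftrightarrow> x = y" by (simp add: infnorm_eq_0)
  show "infnorm (x - z) \<le> infnorm (x - y) + infnorm (y - z)"
    using infnorm_triangle[of "x - y" "y - z"] by simp
qed

lemma mspace_infnorm_metric [simp]: "mspace infnorm_metric = UNIV"
  by (simp add: infnorm_metric_def Metric_space.mspace_metric[OF Metric_space_infnorm])

lemma mdist_infnorm_metric [simp]: "mdist infnorm_metric = (\<lambda>x y. infnorm (x - y))"
  by (simp add: infnorm_metric_def Metric_space.mdist_metric[OF Metric_space_infnorm])

text \<open>
  \<^const>\<open>funspace\<close> is the space of bounded functions with the supremum metric; its points are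
  extended by \<^const>\<open>undefined\<close> outside the index set.
\<close>

definition linf_topology :: "'s set \<Rightarrow> ('s \<Rightarrow> 'b::euclidean_space) topology" where
  "linf_topology S = mtopology_of (funspace S infnorm_metric)"

lemma topspace_linf_topology:
  "topspace (linf_topology S) = {f \<in> extensional S. bounded (f ` S)}"
proof -
  interpret I: Metric_space UNIV "\<lambda>x y::'b. infnorm (x - y)"
    by (rule Metric_space_infnorm)
  have "I.mbounded A \<longleftrightarrow> bounded A" for A
  proof
    assume "I.mbounded A"
    then obtain x B where B: "\<And>y. y \<in> A \<Longrightarrow> infnorm (x - y) \<le> B"
      unfolding I.mbounded_def by (auto simp: subset_iff)
    have "dist x y \<le> sqrt DIM('b) * B" if "y \<in> A" for y
      unfolding dist_norm
      by (rule order_trans[OF norm_le_infnorm mult_left_mono[OF B[OF that]]]) simp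
    then show "bounded A"
      unfolding bounded_def by blast
  next
    assume "bounded A"
    then obtain x B where B: "\<And>y. y \<in> A \<Longrightarrow> dist x y \<le> B"
      unfolding bounded_def by blast
    then have "infnorm (x - y) \<le> B" if "y \<in> A" for y
      using infnorm_le_norm[of "x - y"] that by (force simp: dist_norm)
    then show "I.mbounded A"
      unfolding I.mbounded_def by (auto simp: subset_iff intro!: exI[of _ x] exI[of _ B])
  qed
  then show ?thesis
    by (auto simp: linf_topology_def I.fspace_def)
qed

definition sample_path :: "'t set \<Rightarrow> ('t \<Rightarrow> 'w \<Rightarrow> 'a) \<Rightarrow> 'w \<Rightarrow> 't \<Rightarrow> 'a" where
  "sample_path T X \<omega> = (\<lambda>t\<in>T. X t \<omega>)"


section \<open>The hypotheses on the processes\<close>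

text \<open>
  The extended reals make the infimum over the empty set \<open>\<infinity>\<close>, and \<^const>\<open>e2ennreal\<close> is the
  positive part. In \<open>minimizer_in_compact\<close> the bound with \<open>\<epsilon> < 1\<close> implies that the event is
  measurable, because \<^const>\<open>measure\<close> vanishes on non-measurable sets.
\<close>

locale argmin_processes = prob_space M
  for M :: "'w measure" +
  fixes T :: "'t set"
    and Ln :: "nat \<Rightarrow> 'a::metric_space \<Rightarrow> 't \<Rightarrow> 'w \<Rightarrow> real"
    and L :: "'a \<Rightarrow> 't \<Rightarrow> 'w \<Rightarrow> real"
    and un :: "nat \<Rightarrow> 't \<Rightarrow> 'w \<Rightarrow> 'a"
    and u :: "'t \<Rightarrow> 'w \<Rightarrow> 'a"
  assumes objective_weak_conv:
    "\<And>K. compact K \<Longrightarrow>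
       weak_conv_HJ M (linf_topology (K \<times> T))
         (\<lambda>n. sample_path (K \<times> T) (\<lambda>(\<phi>, t). Ln n \<phi> t)) (sample_path (K \<times> T) (\<lambda>(\<phi>, t). L \<phi> t))"
  and objective_tight:
    "\<And>K. compact K \<Longrightarrow>
       tight_borel_map M (linf_topology (K \<times> T)) (sample_path (K \<times> T) (\<lambda>(\<phi>, t). L \<phi> t))"
  and well_separated:
    "\<And>\<eta> K. \<eta> > 0 \<Longrightarrow> compact K \<Longrightarrow>
       AE \<omega> in M. (INF t \<in> T. (INF \<phi> \<in> {\<phi> \<in> K. dist \<phi> (u t \<omega>) \<ge> \<eta>}. ereal (L \<phi> t \<omega>))
                               - ereal (L (u t \<omega>) t \<omega>)) > 0"
  and minimizer_in_compact:
    "\<And>\<epsilon>. \<epsilon> > 0 \<Longrightarrow> \<exists>K. compact K \<and> measure M {\<omega> \<in> space M. \<forall>t \<in> T. u t \<omega> \<in> K} \<ge> 1 - \<epsilon>"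
  and approx_minimizers_in_compact:
    "\<And>\<epsilon>. \<epsilon> > 0 \<Longrightarrow> \<exists>K. compact K \<and>
       liminf (\<lambda>n. ereal (inner_prob M {\<omega> \<in> space M. \<forall>t \<in> T. un n t \<omega> \<in> K})) \<ge> ereal (1 - \<epsilon>)"
  and approx_minimizing:
    "small_o_outer_prob M
       (\<lambda>n \<omega>. SUP t \<in> T. e2ennreal (ereal (Ln n (un n t \<omega>) t \<omega>) - (INF \<phi>. ereal (Ln n \<phi> t \<omega>))))"

definition is_version :: "'w measure \<Rightarrow> 't set \<Rightarrow> ('t \<Rightarrow> 'w \<Rightarrow> 'a) \<Rightarrow> ('t \<Rightarrow> 'w \<Rightarrow> 'a) \<Rightarrow> bool" where
  "is_version M T X Y \<longleftrightarrow> (\<forall>t \<in> T. AE \<omega> in M. X t \<omega> = Y t \<omega>)"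

text \<open>
  The hypotheses make \<open>t \<mapsto> un n t \<omega>\<close> bounded only with inner probability tending to 1, while
  weak convergence in \<open>\<ell>\<^sup>\<infinity>\<close> is defined for maps with values in \<open>\<ell>\<^sup>\<infinity>\<close>. Convergence of
  \<open>un\<close> is therefore expressed as convergence of every sequence \<open>vn\<close> of bounded modifications,
  which may differ from \<open>un n\<close> only at the \<open>\<omega>\<close> where \<open>un n\<close> is unbounded. If \<open>un n\<close> is bounded
  at every \<open>\<omega>\<close>, it is its own only bounded modification.
\<close>

definition bounded_modification ::
  "'w measure \<Rightarrow> 't set \<Rightarrow> ('t \<Rightarrow> 'w \<Rightarrow> 'a::metric_space) \<Rightarrow> ('t \<Rightarrow> 'w \<Rightarrow> 'a) \<Rightarrow> bool" where
  "bounded_modification M T Y X \<longleftrightarrow>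
     (\<forall>\<omega> \<in> space M. bounded ((\<lambda>t. Y t \<omega>) ` T) \<and>
        (bounded ((\<lambda>t. X t \<omega>) ` T) \<longrightarrow> (\<forall>t \<in> T. Y t \<omega> = X t \<omega>)))"

end

theory Submission
  imports Defs
begin

text \<open>
  A minimizer is not a continuous functional of the objective, and an objective need not even have
  one, so the continuous mapping theorem does not apply directly. The proof replaces the minimizer
  by continuous functionals. Let \<open>f\<close> be continuous on the space of functions \<open>T \<rightarrow> \<Phi>\<close> with
  \<open>\<bar>f\<bar> \<le> B\<close>, and let \<open>K \<subseteq> \<Phi>\<close> be compact. For \<open>g \<in> \<ell>\<^sup>\<infinity>(K \<times> T)\<close>, \<open>penalized_sup\<close> is the
  supremum, over the functions \<open>h : T \<rightarrow> K\<close>, of \<open>f h\<close> minus \<open>k\<close> times the amount by which \<open>h\<close> fails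
  to minimize \<open>g\<close>, uniformly in \<open>t \<in> T\<close>. Three properties make the argument work.

  \<^item> The functional is \<open>2k\<close>-Lipschitz in \<open>g\<close> and takes values in \<open>[-B, B]\<close>. The hypothesis on the
    objectives therefore applies to it: its outer expectations at \<open>Ln\<close> converge to its
    expectation at \<open>L\<close> (\<open>penalized_sup_approx_objective_tendsto\<close>).
  \<^item> If \<open>g\<close> has a well-separated minimizer \<open>h\<close>, then the functional tends to \<open>f h\<close> as \<open>k \<rightarrow> \<infinity>\<close>,
    because a function that nearly minimizes \<open>g\<close> is uniformly close to \<open>h\<close>
    (\<open>penalized_sup_tendsto\<close>).
  \<^item> If \<open>un\<close> takes values in \<open>K\<close> and minimizes \<open>Ln\<close> up to \<open>\<epsilon>\<close>, then \<open>f un\<close> exceeds the value of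
    the functional at \<open>Ln\<close> by at most \<open>k\<epsilon>\<close>.

  Letting \<open>n \<rightarrow> \<infinity>\<close>, then \<open>\<epsilon> \<rightarrow> 0\<close>, then \<open>k \<rightarrow> \<infinity>\<close>, and finally enlarging \<open>K\<close>, gives
  \<open>limsup E\<^sup>*[f un] \<le> E[f u]\<close> (\<open>outer_expectation_minimizers_upper\<close>). The same bound for \<open>-f\<close> yields
  the matching lower bound (\<open>weak_conv_HJI\<close>).

  The second property also makes \<open>u\<close> measurable. Outside one null set, \<open>f u\<close> is a pointwise limit of
  measurable functions for every bounded continuous \<open>f\<close>, and the null set does not depend on \<open>f\<close>. In
  a metrizable space this forces the Borel measurability of \<open>u\<close>, once it is redefined on the null
  set (\<open>measurable_borel_sigma_metrizableI\<close>, \<open>measurable_minimizer\<close>).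

  Only three properties of the space of functions \<open>T \<rightarrow> \<Phi>\<close> enter: it is metrizable, it contains all
  functions with values in a compact set, and its open sets contain uniform balls. Both
  \<open>\<Phi>\<^sup>T\<close> for finite \<open>T\<close> and \<open>\<ell>\<^sup>\<infinity>(T, \<real>\<^sup>p)\<close> have them, so the two cases are instances of
  one theorem, \<open>weak_conv_minimizers\<close>.
\<close>

section \<open>Topologies on function spaces\<close>

lemma openin_linf_topology:
  fixes U :: "('s \<Rightarrow> 'b::euclidean_space) set"
  shows "openin (linf_topology S) U \<longleftrightarrow> U \<subseteq> topspace (linf_topology S) \<and>
    (\<forall>g\<in>U. \<exists>r>0. \<forall>g'\<in>topspace (linf_topology S).
       (\<forall>s\<in>S. infnorm (g s - g' s) \<le> r) \<longrightarrow> g' \<in> U)"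
proof -
  interpret I: Metric_space UNIV "\<lambda>x y::'b. infnorm (x - y)"
    by (rule Metric_space_infnorm)
  interpret F: Metric_space "I.fspace S" "I.fdist S"
    by (rule I.Metric_space_funspace)
  have top: "linf_topology S = F.mtopology"
    by (simp add: linf_topology_def mtopology_of_def)
  have dist: "I.fdist S g g' \<le> r \<longleftrightarrow> (\<forall>s\<in>S. infnorm (g s - g' s) \<le> r)"
    if "g \<in> I.fspace S" "g' \<in> I.fspace S" "r > 0" for g g' r
  proof (cases "S = {}")
    case True
    then show ?thesis using that by simp
  next
    case False
    then show ?thesis using that I.funspace_mdist_le by blast
  qed
  have ball: "F.mcball g r \<subseteq> U \<longleftrightarrow>
      (\<forall>g'\<in>I.fspace S. (\<forall>s\<in>S. infnorm (g s - g' s) \<le> r) \<longrightarrow> g' \<in> U)"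
    if "g \<in> I.fspace S" "r > 0" for g r
    using dist[OF that(1) _ that(2)] that(1) by (auto simp: F.in_mcball subset_iff)
  show ?thesis
    unfolding top F.topspace_mtopology F.openin_mtopology_mcball
  proof (intro conj_cong refl)
    assume "U \<subseteq> I.fspace S"
    then have "F.mcball g r \<subseteq> U \<longleftrightarrow>
        (\<forall>g'\<in>I.fspace S. (\<forall>s\<in>S. infnorm (g s - g' s) \<le> r) \<longrightarrow> g' \<in> U)"
      if "g \<in> U" "r > 0" for g r
      using that by (intro ball) auto
    then show "(\<forall>g. g \<in> U \<longrightarrow> (\<exists>r>0. F.mcball g r \<subseteq> U)) \<longleftrightarrow>
        (\<forall>g\<in>U. \<exists>r>0. \<forall>g'\<in>I.fspace S. (\<forall>s\<in>S. infnorm (g s - g' s) \<le> r) \<longrightarrow> g' \<in> U)"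
      by (auto simp: Ball_def cong: conj_cong)
  qed
qed

lemma metrizable_space_linf_topology: "metrizable_space (linf_topology S)"
  unfolding linf_topology_def mtopology_of_def
  by (intro Metric_space.metrizable_space_mtopology Metric_space_mspace_mdist)

lemma continuous_map_linf_topology_Lipschitz:
  fixes F :: "('s \<Rightarrow> real) \<Rightarrow> real"
  assumes "C \<ge> 0"
    and lip: "\<And>g g' r. g \<in> topspace (linf_topology S) \<Longrightarrow> g' \<in> topspace (linf_topology S) \<Longrightarrow> r > 0 \<Longrightarrow>
      (\<And>s. s \<in> S \<Longrightarrow> \<bar>g s - g' s\<bar> \<le> r) \<Longrightarrow> \<bar>F g - F g'\<bar> \<le> C * r"
  shows "continuous_map (linf_topology S) euclideanreal F"
  unfolding continuous_map_def
proof (intro conjI allI impI)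
  let ?L = "linf_topology S :: ('s \<Rightarrow> real) topology"
  show "F \<in> topspace ?L \<rightarrow> topspace euclideanreal" by simp
  fix V :: "real set" assume "openin euclideanreal V"
  then have V: "open V" by simp
  have "\<exists>r>0. \<forall>g'\<in>topspace ?L. (\<forall>s\<in>S. infnorm (g s - g' s) \<le> r) \<longrightarrow>
          g' \<in> topspace ?L \<and> F g' \<in> V"
    if g: "g \<in> topspace ?L" "F g \<in> V" for g
  proof -
    obtain e where e: "e > 0" "\<And>y. dist y (F g) < e \<Longrightarrow> y \<in> V"
      using V g(2) unfolding open_dist by blast
    define r where "r = e / (2 * (C + 1))"
    have r: "r > 0" "C * r < e"
      using e(1) \<open>C \<ge> 0\<close> by (auto simp: r_def field_simps intro: add_nonneg_pos)
    have "F g' \<in> V" if "g' \<in> topspace ?L" "\<forall>s\<in>S. infnorm (g s - g' s) \<le> r" for g'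
    proof -
      have "\<bar>F g - F g'\<bar> \<le> C * r"
        using that by (intro lip g(1) r(1)) (auto simp: infnorm_def)
      then show ?thesis
        using r(2) by (intro e(2)) (auto simp: dist_real_def)
    qed
    then show ?thesis using r(1) by blast
  qed
  then show "openin ?L {g \<in> topspace ?L. F g \<in> V}"
    unfolding openin_linf_topology[of S "{g \<in> topspace ?L. F g \<in> V}"] by blast
qed

text \<open>
  A basic neighbourhood constrains each coordinate separately; finitely many coordinates admit a
  common radius.
\<close>

lemma openin_product_euclidean_contains_uniform_ball:
  fixes U :: "('t \<Rightarrow> 'a::metric_space) set"
  assumes "finite T" "openin (product_topology (\<lambda>_. euclidean) T) U" "h \<in> U"
  shows "\<exists>\<eta>>0. \<forall>h'\<in>T \<rightarrow>\<^sub>E UNIV. (\<forall>t\<in>T. dist (h' t) (h t) < \<eta>) \<longrightarrow> h' \<in> U"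
proof -
  obtain V where V: "\<And>t. t \<in> T \<Longrightarrow> open (V t)" "h \<in> Pi\<^sub>E T V" "Pi\<^sub>E T V \<subseteq> U"
    using assms(2,3) unfolding openin_product_topology_alt by fastforce
  have "\<exists>e>0. \<forall>y. dist y (h t) < e \<longrightarrow> y \<in> V t" if "t \<in> T" for t
    using V(1)[OF that] V(2) that unfolding open_dist by blast
  then obtain e where e: "\<And>t. t \<in> T \<Longrightarrow> e t > 0"
      "\<And>t y. t \<in> T \<Longrightarrow> dist y (h t) < e t \<Longrightarrow> y \<in> V t"
    by metis
  define \<eta> where "\<eta> = Min (insert 1 (e ` T))"
  have \<eta>: "\<eta> > 0" "\<And>t. t \<in> T \<Longrightarrow> \<eta> \<le> e t"
    using assms(1) e(1) by (auto simp: \<eta>_def)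
  have "h' \<in> U" if "h' \<in> T \<rightarrow>\<^sub>E UNIV" "\<forall>t\<in>T. dist (h' t) (h t) < \<eta>" for h'
  proof -
    have "h' t \<in> V t" if "t \<in> T" for t
      using e(2)[OF that] \<eta>(2)[OF that] \<open>\<forall>t\<in>T. dist (h' t) (h t) < \<eta>\<close> that
      by (meson order_less_le_trans)
    then have "h' \<in> Pi\<^sub>E T V"
      using that(1) by (auto simp: PiE_iff)
    then show ?thesis using V(3) by blast
  qed
  then show ?thesis using \<eta>(1) by blast
qed

lemma openin_linf_topology_contains_uniform_ball:
  fixes U :: "('t \<Rightarrow> 'b::euclidean_space) set"
  assumes "openin (linf_topology T) U" "h \<in> U"
  shows "\<exists>\<eta>>0. \<forall>h'\<in>topspace (linf_topology T). (\<forall>t\<in>T. dist (h' t) (h t) < \<eta>) \<longrightarrow> h' \<in> U"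
proof -
  obtain r where r: "r > 0"
    "\<And>h'. h' \<in> topspace (linf_topology T) \<Longrightarrow> (\<forall>t\<in>T. infnorm (h t - h' t) \<le> r) \<Longrightarrow> h' \<in> U"
    using assms unfolding openin_linf_topology[of T U] by blast
  have "infnorm (h t - h' t) \<le> r" if "dist (h' t) (h t) < r" for h' t
    using that infnorm_le_norm[of "h t - h' t"] by (simp add: dist_norm norm_minus_commute)
  then show ?thesis using r by blast
qed

section \<open>Borel maps and outer expectations\<close>

lemma
  shows space_borel_sigma [simp]: "space (borel_sigma D) = topspace D"
    and sets_borel_sigma: "sets (borel_sigma D) = sigma_sets (topspace D) {U. openin D U}"
  using openin_subset by (auto simp: borel_sigma_def intro!: sets_measure_of space_measure_of)

lemma borel_measurable_comp_continuous_map: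
  assumes "continuous_map D euclideanreal f" "X \<in> M \<rightarrow>\<^sub>M borel_sigma D"
  shows "(\<lambda>\<omega>. f (X \<omega>)) \<in> borel_measurable M"
proof -
  have "f \<in> borel_measurable (borel_sigma D)"
  proof (rule borel_measurableI)
    fix S :: "real set" assume "open S"
    then have "openin D {x \<in> topspace D. f x \<in> S}"
      using assms(1) by (simp add: continuous_map_def)
    moreover have "f -` S \<inter> space (borel_sigma D) = {x \<in> topspace D. f x \<in> S}"
      by auto
    ultimately show "f -` S \<inter> space (borel_sigma D) \<in> sets (borel_sigma D)"
      by (simp add: sets_borel_sigma)
  qed
  then show ?thesis
    using assms(2) by (rule measurable_compose[rotated])
qed

text \<open>
  An open set of a metrizable space is a countable union of closed sets, and by Urysohn's lemma each
  of them is separated from the complement by a continuous function. The open set is thus the union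
  of the sets where these countably many functions are positive.
\<close>

lemma measurable_borel_sigma_metrizableI:
  assumes D: "metrizable_space D" and X: "X \<in> space M \<rightarrow> topspace D"
    and comp: "\<And>f. continuous_map D euclideanreal f \<Longrightarrow> bounded (f ` topspace D) \<Longrightarrow>
      (\<lambda>\<omega>. f (X \<omega>)) \<in> borel_measurable M"
  shows "X \<in> M \<rightarrow>\<^sub>M borel_sigma D"
  unfolding borel_sigma_def
proof (rule measurable_measure_of)
  show "{U. openin D U} \<subseteq> Pow (topspace D)" using openin_subset by auto
  show "X \<in> space M \<rightarrow> topspace D" by fact
  fix U assume "U \<in> {U. openin D U}"
  then have U: "openin D U" by simp
  obtain C where C: "\<And>n::nat. closedin D (C n)" "\<Union> (range C) = U"
    using open_imp_fsigma_in[OF D U] unfolding fsigma_in_ascending by blast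
  have "\<exists>f. continuous_map D (top_of_set {0..1::real}) f \<and>
      f ` (topspace D - U) \<subseteq> {0} \<and> f ` C n \<subseteq> {1}" for n
  proof -
    have "closedin D (topspace D - U)" "disjnt (topspace D - U) (C n)"
      using U C(2) by (auto simp: disjnt_def)
    then show ?thesis
      using Urysohn_lemma[OF metrizable_imp_normal_space[OF D], of "topspace D - U" "C n" 0 1] C(1)
      by (metis zero_le_one)
  qed
  then obtain f where f: "\<And>n. continuous_map D (top_of_set {0..1::real}) (f n)"
      "\<And>n. f n ` (topspace D - U) \<subseteq> {0}" "\<And>n. f n ` C n \<subseteq> {1}"
    by metis
  have meas: "(\<lambda>\<omega>. f n (X \<omega>)) \<in> borel_measurable M" for n
  proof (rule comp)
    show "continuous_map D euclideanreal (f n)"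
      using f(1) by (rule continuous_map_into_fulltopology)
    have "f n ` topspace D \<subseteq> {0..1}"
      using continuous_map_image_subset_topspace[OF f(1)] by simp
    then show "bounded (f n ` topspace D)"
      using bounded_closed_interval bounded_subset by blast
  qed
  have "X -` U \<inter> space M = (\<Union>n. {\<omega> \<in> space M. f n (X \<omega>) > 0})"
  proof (intro set_eqI iffI)
    fix \<omega> assume "\<omega> \<in> X -` U \<inter> space M"
    then obtain n where "X \<omega> \<in> C n" "\<omega> \<in> space M" using C(2) by auto
    then show "\<omega> \<in> (\<Union>n. {\<omega> \<in> space M. f n (X \<omega>) > 0})"
      using f(3)[of n] by (auto intro!: exI[of _ n] simp: image_subset_iff)
  next
    fix \<omega> assume "\<omega> \<in> (\<Union>n. {\<omega> \<in> space M. f n (X \<omega>) > 0})"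
    then obtain n where n: "\<omega> \<in> space M" "f n (X \<omega>) > 0" by auto
    then show "\<omega> \<in> X -` U \<inter> space M"
      using f(2)[of n] X by force
  qed
  also have "\<dots> \<in> sets M"
    using meas by measurable
  finally show "X -` U \<inter> space M \<in> sets M" .
qed

lemma outer_expectation_le_add_integral:
  assumes "integrable M W" "\<And>\<omega>. \<omega> \<in> space M \<Longrightarrow> Z \<omega> \<le> Y \<omega> + W \<omega>"
  shows "outer_expectation M Z \<le> outer_expectation M Y + ereal (integral\<^sup>L M W)"
proof -
  have "outer_expectation M Z - ereal (integral\<^sup>L M W) \<le> outer_expectation M Y"
    unfolding outer_expectation_def[of M Y]
  proof (rule INF_greatest)
    fix V assume "V \<in> {V. integrable M V \<and> (\<forall>\<omega> \<in> space M. Y \<omega> \<le> V \<omega>)}"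
    then have V: "integrable M V" "\<forall>\<omega> \<in> space M. Y \<omega> \<le> V \<omega>" by auto
    have "outer_expectation M Z \<le> ereal (integral\<^sup>L M (\<lambda>\<omega>. V \<omega> + W \<omega>))"
      unfolding outer_expectation_def
      using V assms by (intro INF_lower) fastforce
    also have "\<dots> = ereal (integral\<^sup>L M V) + ereal (integral\<^sup>L M W)"
      using V(1) assms(1) by simp
    finally show "outer_expectation M Z - ereal (integral\<^sup>L M W) \<le> ereal (integral\<^sup>L M V)"
      by (simp add: ereal_minus_le)
  qed
  then show ?thesis by (simp add: ereal_minus_le)
qed

text \<open>
  The sum of a majorant of \<open>Z\<close> and a majorant of \<open>-Z\<close> is nonnegative. This transfers upper
  bounds for \<open>-Z\<close> to lower bounds for \<open>Z\<close>.
\<close>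

lemma outer_expectation_uminus_greater:
  assumes "outer_expectation M (\<lambda>\<omega>. - Z \<omega>) < ereal a"
  shows "ereal (- a) < outer_expectation M Z"
proof -
  obtain V where V: "integrable M V" "\<forall>\<omega> \<in> space M. - Z \<omega> \<le> V \<omega>" "integral\<^sup>L M V < a"
    using assms unfolding outer_expectation_def INF_less_iff by auto
  have "ereal (- integral\<^sup>L M V) \<le> outer_expectation M Z"
    unfolding outer_expectation_def[of M Z]
  proof (rule INF_greatest)
    fix W assume "W \<in> {V. integrable M V \<and> (\<forall>\<omega> \<in> space M. Z \<omega> \<le> V \<omega>)}"
    then have W: "integrable M W" "\<forall>\<omega> \<in> space M. Z \<omega> \<le> W \<omega>" by auto
    have "integral\<^sup>L M (\<lambda>\<omega>. - V \<omega>) \<le> integral\<^sup>L M W"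
      using V W by (intro integral_mono) force+
    then show "ereal (- integral\<^sup>L M V) \<le> ereal (integral\<^sup>L M W)" by simp
  qed
  then show ?thesis using V(3) by (metis ereal_less_eq(3) less_ereal.simps(1) neg_less_iff_less order_less_le_trans)
qed

text \<open>
  One-sided bounds suffice because the class of test functions is closed under negation.
\<close>

lemma (in prob_space) weak_conv_HJI:
  assumes maps: "\<And>n. Xs n \<in> space M \<rightarrow> topspace D" "X \<in> M \<rightarrow>\<^sub>M borel_sigma D"
    and upper: "\<And>f \<delta>. continuous_map D euclideanreal f \<Longrightarrow> bounded (f ` topspace D) \<Longrightarrow> \<delta> > 0 \<Longrightarrow>
      \<forall>\<^sub>F n in sequentially. outer_expectation M (\<lambda>\<omega>. f (Xs n \<omega>))
         < ereal (expectation (\<lambda>\<omega>. f (X \<omega>)) + \<delta>)"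
  shows "weak_conv_HJ M D Xs X"
  unfolding weak_conv_HJ_def
proof (intro conjI allI impI)
  fix f assume "continuous_map D euclideanreal f \<and> bounded (f ` topspace D)"
  then have f: "continuous_map D euclideanreal f" "bounded (f ` topspace D)" by auto
  then have f': "continuous_map D euclideanreal (\<lambda>x. - f x)" "bounded ((\<lambda>x. - f x) ` topspace D)"
    by (simp_all add: continuous_map_minus bounded_iff)
  show "(\<lambda>n. outer_expectation M (\<lambda>\<omega>. f (Xs n \<omega>))) \<longlonglongrightarrow> ereal (expectation (\<lambda>\<omega>. f (X \<omega>)))"
  proof (rule order_tendstoI)
    fix a assume "ereal (expectation (\<lambda>\<omega>. f (X \<omega>))) < a"
    then obtain \<delta> where "\<delta> > 0" "ereal (expectation (\<lambda>\<omega>. f (X \<omega>)) + \<delta>) < a"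
    proof -
      obtain b where "expectation (\<lambda>\<omega>. f (X \<omega>)) < b" "ereal b < a"
        using ereal_dense2[OF \<open>ereal _ < a\<close>] by auto
      then show thesis
        by (intro that[of "b - expectation (\<lambda>\<omega>. f (X \<omega>))"]) auto
    qed
    with upper[OF f \<open>\<delta> > 0\<close>]
    show "\<forall>\<^sub>F n in sequentially. outer_expectation M (\<lambda>\<omega>. f (Xs n \<omega>)) < a"
      by (auto elim!: eventually_mono)
  next
    fix a assume "a < ereal (expectation (\<lambda>\<omega>. f (X \<omega>)))"
    then obtain b where b: "a < ereal b" "b < expectation (\<lambda>\<omega>. f (X \<omega>))"
      using ereal_dense2[of a "ereal (expectation (\<lambda>\<omega>. f (X \<omega>)))"] by auto
    then have "\<forall>\<^sub>F n in sequentially. outer_expectation M (\<lambda>\<omega>. - f (Xs n \<omega>)) < ereal (- b)"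
      using upper[OF f', of "expectation (\<lambda>\<omega>. f (X \<omega>)) - b"] by simp
    then show "\<forall>\<^sub>F n in sequentially. a < outer_expectation M (\<lambda>\<omega>. f (Xs n \<omega>))"
      using b(1) by (auto elim!: eventually_mono dest!: outer_expectation_uminus_greater)
  qed
qed (use maps in auto)

lemma (in prob_space) outer_prob_lessD:
  assumes "A \<subseteq> space M" "outer_prob M A < r"
  obtains B where "B \<in> sets M" "A \<subseteq> B" "prob B < r"
proof -
  have "{B \<in> sets M. A \<subseteq> B} \<noteq> {}" using assms(1) by blast
  then show thesis
    using assms(2) that unfolding outer_prob_def
    by (subst (asm) cINF_less_iff) (auto intro: bdd_belowI2[of _ 0])
qed

section \<open>Penalized suprema\<close>

text \<open>
  The excess \<open>s\<close> is one number for all \<open>t \<in> T\<close>: closeness of near-minimizers to the minimizer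
  has to be uniform in \<open>t\<close>.
\<close>

definition near_minimizer :: "'a set \<Rightarrow> 't set \<Rightarrow> ('a \<times> 't \<Rightarrow> real) \<Rightarrow> real \<Rightarrow> ('t \<Rightarrow> 'a) \<Rightarrow> bool" where
  "near_minimizer K T g s h \<longleftrightarrow>
     h \<in> T \<rightarrow>\<^sub>E K \<and> 0 \<le> s \<and> (\<forall>t\<in>T. \<forall>\<phi>\<in>K. g (h t, t) \<le> g (\<phi>, t) + s)"

text \<open>
  Maximizing over pairs of a function \<open>h\<close> and an admissible excess \<open>s\<close> is the same as charging \<open>h\<close>
  for its least excess, but involves no infimum of \<open>g\<close> and no supremum over a possibly empty \<open>T\<close>. The
  inserted value \<open>-B\<close> keeps the set nonempty and bounds the result below uniformly in \<open>g\<close> and \<open>k\<close>; it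
  does not compete with the value \<open>f h\<close> of an exact minimizer.
\<close>

definition penalized_sup ::
  "(('t \<Rightarrow> 'a) \<Rightarrow> real) \<Rightarrow> real \<Rightarrow> 'a set \<Rightarrow> 't set \<Rightarrow> real \<Rightarrow> ('a \<times> 't \<Rightarrow> real) \<Rightarrow> real" where
  "penalized_sup f B K T k g = Sup (insert (- B) {f h - k * s | h s. near_minimizer K T g s h})"

context
  fixes f :: "('t \<Rightarrow> 'a) \<Rightarrow> real" and B k :: real and K :: "'a set" and T :: "'t set"
  assumes f_bound: "\<And>h. h \<in> T \<rightarrow>\<^sub>E K \<Longrightarrow> \<bar>f h\<bar> \<le> B" and B_nonneg: "B \<ge> 0" and k_nonneg: "k \<ge> 0"
begin

lemma penalized_value_le: "near_minimizer K T g s h \<Longrightarrow> f h - k * s \<le> B"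
proof -
  assume h: "near_minimizer K T g s h"
  then have "0 \<le> k * s" "\<bar>f h\<bar> \<le> B"
    using f_bound k_nonneg by (auto simp: near_minimizer_def)
  then show ?thesis by linarith
qed

lemma bdd_above_penalized_values:
  "bdd_above (insert (- B) {f h - k * s | h s. near_minimizer K T g s h})"
  using penalized_value_le B_nonneg by (intro bdd_aboveI[of _ B]) auto

lemma penalized_sup_upper: "near_minimizer K T g s h \<Longrightarrow> f h - k * s \<le> penalized_sup f B K T k g"
  unfolding penalized_sup_def using bdd_above_penalized_values by (intro cSup_upper) auto

lemma penalized_sup_ge: "- B \<le> penalized_sup f B K T k g"
  unfolding penalized_sup_def using bdd_above_penalized_values by (intro cSup_upper) auto

lemma penalized_sup_least:
  "- B \<le> c \<Longrightarrow> (\<And>h s. near_minimizer K T g s h \<Longrightarrow> f h - k * s \<le> c) \<Longrightarrow> penalized_sup f B K T k g \<le> c"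
  unfolding penalized_sup_def by (intro cSup_least) auto

lemma abs_penalized_sup_le: "\<bar>penalized_sup f B K T k g\<bar> \<le> B"
proof (rule abs_leI)
  show "penalized_sup f B K T k g \<le> B"
    using B_nonneg by (intro penalized_sup_least penalized_value_le) auto
  show "- penalized_sup f B K T k g \<le> B"
    using penalized_sup_ge[of g] by simp
qed

text \<open>
  Changing the objective by at most \<open>r\<close> changes both sides of the defining inequality of a
  near-minimizer by at most \<open>r\<close>, so an excess \<open>s\<close> for \<open>g\<close> becomes an excess \<open>s + 2r\<close> for \<open>g'\<close>.
\<close>

lemma penalized_sup_Lipschitz_le:
  assumes "r \<ge> 0" and close: "\<And>s. s \<in> K \<times> T \<Longrightarrow> \<bar>g s - g' s\<bar> \<le> r"
  shows "penalized_sup f B K T k g \<le> penalized_sup f B K T k g' + 2 * k * r"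
proof (rule penalized_sup_least)
  show "- B \<le> penalized_sup f B K T k g' + 2 * k * r"
    using penalized_sup_ge[of g'] k_nonneg assms(1) by (simp add: add_increasing2)
  fix h s assume h: "near_minimizer K T g s h"
  have "near_minimizer K T g' (s + 2 * r) h"
    unfolding near_minimizer_def
  proof (intro conjI ballI)
    show "h \<in> T \<rightarrow>\<^sub>E K" "0 \<le> s + 2 * r" using h assms(1) by (auto simp: near_minimizer_def)
    fix t \<phi> assume t: "t \<in> T" "\<phi> \<in> K"
    then have "h t \<in> K" "g (h t, t) \<le> g (\<phi>, t) + s" using h by (auto simp: near_minimizer_def)
    then show "g' (h t, t) \<le> g' (\<phi>, t) + (s + 2 * r)"
      using close[of "(h t, t)"] close[of "(\<phi>, t)"] t by auto
  qed
  from penalized_sup_upper[OF this]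
  show "f h - k * s \<le> penalized_sup f B K T k g' + 2 * k * r" by (simp add: algebra_simps)
qed

lemma continuous_map_penalized_sup:
  "continuous_map (linf_topology (K \<times> T)) euclideanreal (penalized_sup f B K T k)"
proof (rule continuous_map_linf_topology_Lipschitz)
  show "0 \<le> 2 * k" using k_nonneg by simp
  fix g g' :: "'a \<times> 't \<Rightarrow> real" and r :: real
  assume "r > 0" and close: "\<And>s. s \<in> K \<times> T \<Longrightarrow> \<bar>g s - g' s\<bar> \<le> r"
  then show "\<bar>penalized_sup f B K T k g - penalized_sup f B K T k g'\<bar> \<le> 2 * k * r"
    using penalized_sup_Lipschitz_le[of r g g'] penalized_sup_Lipschitz_le[of r g' g]
    by (simp add: abs_le_iff abs_minus_commute)
qed

end

definition well_separated_minimizer ::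
  "'a::metric_space set \<Rightarrow> 't set \<Rightarrow> ('a \<times> 't \<Rightarrow> real) \<Rightarrow> ('t \<Rightarrow> 'a) \<Rightarrow> bool" where
  "well_separated_minimizer K T g h \<longleftrightarrow>
     h \<in> T \<rightarrow>\<^sub>E K \<and>
     (\<forall>\<eta>>0. \<exists>c>0. \<forall>t\<in>T. \<forall>\<phi>\<in>K. dist \<phi> (h t) \<ge> \<eta> \<longrightarrow> g (h t, t) + c < g (\<phi>, t))"

lemma near_minimizer_well_separated:
  assumes "well_separated_minimizer K T g h"
  shows "near_minimizer K T g 0 h"
  unfolding near_minimizer_def
proof (intro conjI ballI)
  show "h \<in> T \<rightarrow>\<^sub>E K" using assms by (simp add: well_separated_minimizer_def)
  fix t \<phi> assume "t \<in> T" "\<phi> \<in> K"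
  then show "g (h t, t) \<le> g (\<phi>, t) + 0"
    using assms unfolding well_separated_minimizer_def
    by (cases "\<phi> = h t") (force dest!: spec[of _ "dist \<phi> (h t)"])+
qed simp

text \<open>
  Choose \<open>\<eta>\<close> such that \<open>f\<close> increases by at most \<open>\<epsilon>\<close> within uniform distance \<open>\<eta>\<close> of the minimizer, and
  let \<open>c\<close> be the gap that separation provides for \<open>\<eta>\<close>. A competitor with excess at most \<open>c\<close> lies
  within \<open>\<eta>\<close> of the minimizer; one with larger excess pays a penalty \<open>kc \<ge> 2B\<close> for large \<open>k\<close> and
  cannot win. The minimizer itself pays nothing.
\<close>

lemma penalized_sup_tendsto:
  fixes h :: "'t \<Rightarrow> 'a::metric_space"
  assumes f_bound: "\<And>h. h \<in> T \<rightarrow>\<^sub>E K \<Longrightarrow> \<bar>f h\<bar> \<le> B"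
    and sep: "well_separated_minimizer K T g h"
    and cont: "\<And>\<epsilon>. \<epsilon> > 0 \<Longrightarrow> \<exists>\<eta>>0. \<forall>h'\<in>T \<rightarrow>\<^sub>E K. (\<forall>t\<in>T. dist (h' t) (h t) < \<eta>) \<longrightarrow> f h' \<le> f h + \<epsilon>"
  shows "(\<lambda>k. penalized_sup f B K T (real k) g) \<longlonglongrightarrow> f h"
proof -
  have h: "h \<in> T \<rightarrow>\<^sub>E K" using sep by (simp add: well_separated_minimizer_def)
  then have B: "B \<ge> 0" "\<bar>f h\<bar> \<le> B" using f_bound[OF h] by auto
  have lower: "f h \<le> penalized_sup f B K T (real k) g" for k
    using penalized_sup_upper[where k="real k", OF f_bound B(1) _ near_minimizer_well_separated[OF sep]]
    by simp
  have upper: "\<forall>\<^sub>F k in sequentially. penalized_sup f B K T (real k) g \<le> f h + \<epsilon>" if "\<epsilon> > 0" for \<epsilon>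
  proof -
    obtain \<eta> where \<eta>: "\<eta> > 0"
      "\<And>h'. h' \<in> T \<rightarrow>\<^sub>E K \<Longrightarrow> (\<forall>t\<in>T. dist (h' t) (h t) < \<eta>) \<Longrightarrow> f h' \<le> f h + \<epsilon>"
      using cont[OF \<open>\<epsilon> > 0\<close>] by blast
    obtain c where c: "c > 0"
      "\<And>t \<phi>. t \<in> T \<Longrightarrow> \<phi> \<in> K \<Longrightarrow> dist \<phi> (h t) \<ge> \<eta> \<Longrightarrow> g (h t, t) + c < g (\<phi>, t)"
      using sep \<eta>(1) unfolding well_separated_minimizer_def by blast
    have "penalized_sup f B K T (real k) g \<le> f h + \<epsilon>" if k: "real k \<ge> 2 * B / c" for k
    proof (rule penalized_sup_least)
      show "- B \<le> f h + \<epsilon>" using B \<open>\<epsilon> > 0\<close> by auto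
      fix h' s assume h': "near_minimizer K T g s h'"
      then have h'K: "h' \<in> T \<rightarrow>\<^sub>E K" and s: "s \<ge> 0"
        and le: "\<And>t. t \<in> T \<Longrightarrow> g (h' t, t) \<le> g (h t, t) + s"
        using h unfolding near_minimizer_def by (auto simp: PiE_iff)
      show "f h' - real k * s \<le> f h + \<epsilon>"
      proof (cases "s \<le> c")
        case True
        have "dist (h' t) (h t) < \<eta>" if "t \<in> T" for t
          using le[OF that] c(2)[OF that, of "h' t"] True h'K that by (force simp: PiE_iff)
        then have "f h' \<le> f h + \<epsilon>" using \<eta>(2) h'K by blast
        then show ?thesis using s by (simp add: add_increasing2 diff_le_eq)
      next
        case False
        have "2 * B \<le> real k * c" using k c(1) by (simp add: field_simps)
        also have "\<dots> \<le> real k * s" using False by (simp add: mult_left_mono)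
        finally show ?thesis using f_bound[OF h'K] B(2) \<open>\<epsilon> > 0\<close> by auto
      qed
    qed (use f_bound B in auto)
    then show ?thesis
      by (metis (mono_tags, lifting) eventually_sequentiallyI nat_ceiling_le_eq)
  qed
  show ?thesis
  proof (rule order_tendstoI)
    fix a assume "a < f h"
    then show "\<forall>\<^sub>F k in sequentially. a < penalized_sup f B K T (real k) g"
      by (intro always_eventually allI order_less_le_trans[OF _ lower])
  next
    fix a assume "f h < a"
    then have "(a - f h) / 2 > 0" by simp
    from upper[OF this] show "\<forall>\<^sub>F k in sequentially. penalized_sup f B K T (real k) g < a"
      by (rule eventually_mono) (use \<open>f h < a\<close> in \<open>simp add: field_simps\<close>)
  qed
qed

section \<open>The limiting minimizer\<close>

context argmin_processes
begin

text \<open>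
  The paths restricted to \<open>K \<times> T\<close> are the points of \<open>\<ell>\<^sup>\<infinity>(K \<times> T)\<close> on which the functionals above
  act.
\<close>

definition objective :: "'a set \<Rightarrow> 'w \<Rightarrow> 'a \<times> 't \<Rightarrow> real" where
  "objective K = sample_path (K \<times> T) (\<lambda>(\<phi>, t). L \<phi> t)"

definition approx_objective :: "'a set \<Rightarrow> nat \<Rightarrow> 'w \<Rightarrow> 'a \<times> 't \<Rightarrow> real" where
  "approx_objective K n = sample_path (K \<times> T) (\<lambda>(\<phi>, t). Ln n \<phi> t)"

lemma objective_apply [simp]: "\<phi> \<in> K \<Longrightarrow> t \<in> T \<Longrightarrow> objective K \<omega> (\<phi>, t) = L \<phi> t \<omega>"
  by (simp add: objective_def sample_path_def)

lemma approx_objective_apply [simp]: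
  "\<phi> \<in> K \<Longrightarrow> t \<in> T \<Longrightarrow> approx_objective K n \<omega> (\<phi>, t) = Ln n \<phi> t \<omega>"
  by (simp add: approx_objective_def sample_path_def)

lemma weak_conv_objective:
  "compact K \<Longrightarrow> weak_conv_HJ M (linf_topology (K \<times> T)) (approx_objective K) (objective K)"
  unfolding objective_def approx_objective_def by (rule objective_weak_conv)

text \<open>
  The exceptional null set of the separation hypothesis depends on \<open>\<eta>\<close>. The countably many values
  \<open>\<eta> = 1 / (j + 1)\<close> suffice, because the separation for a smaller \<open>\<eta>\<close> implies that for a larger one.
\<close>

lemma AE_well_separated_minimizer:
  assumes "compact K"
  shows "AE \<omega> in M. (\<forall>t\<in>T. u t \<omega> \<in> K) \<longrightarrow>
    well_separated_minimizer K T (objective K \<omega>) (sample_path T u \<omega>)"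
proof -
  have "AE \<omega> in M. \<forall>j::nat. (INF t \<in> T. (INF \<phi> \<in> {\<phi> \<in> K. dist \<phi> (u t \<omega>) \<ge> 1 / Suc j}. ereal (L \<phi> t \<omega>))
                               - ereal (L (u t \<omega>) t \<omega>)) > 0"
    unfolding AE_all_countable using well_separated[OF _ assms] by simp
  then show ?thesis
  proof (rule AE_mp, intro AE_I2 impI)
    fix \<omega>
    assume *: "\<forall>j::nat. (INF t \<in> T. (INF \<phi> \<in> {\<phi> \<in> K. dist \<phi> (u t \<omega>) \<ge> 1 / Suc j}. ereal (L \<phi> t \<omega>))
                               - ereal (L (u t \<omega>) t \<omega>)) > 0"
      and u: "\<forall>t\<in>T. u t \<omega> \<in> K"
    show "well_separated_minimizer K T (objective K \<omega>) (sample_path T u \<omega>)"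
      unfolding well_separated_minimizer_def
    proof (intro conjI allI impI)
      show "sample_path T u \<omega> \<in> T \<rightarrow>\<^sub>E K" using u by (simp add: sample_path_def)
      fix \<eta> :: real assume "\<eta> > 0"
      then obtain j where j: "1 / Suc j < \<eta>" using nat_approx_posE by blast
      obtain c where c: "0 < ereal c" "ereal c < (INF t \<in> T. (INF \<phi> \<in> {\<phi> \<in> K. dist \<phi> (u t \<omega>) \<ge> 1 / Suc j}.
          ereal (L \<phi> t \<omega>)) - ereal (L (u t \<omega>) t \<omega>))"
        using ereal_dense2[OF *[rule_format, of j]] by blast
      have "L (u t \<omega>) t \<omega> + c < L \<phi> t \<omega>" if "t \<in> T" "\<phi> \<in> K" "dist \<phi> (u t \<omega>) \<ge> \<eta>" for t \<phi>
      proof -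
        have "ereal c < (INF \<phi> \<in> {\<phi> \<in> K. dist \<phi> (u t \<omega>) \<ge> 1 / Suc j}. ereal (L \<phi> t \<omega>))
            - ereal (L (u t \<omega>) t \<omega>)"
          using c(2) that(1) by (rule less_INF_D)
        also have "\<dots> \<le> ereal (L \<phi> t \<omega>) - ereal (L (u t \<omega>) t \<omega>)"
          using that j by (intro ereal_minus_mono INF_lower) auto
        finally show ?thesis by simp
      qed
      then show "\<exists>c>0. \<forall>t\<in>T. \<forall>\<phi>\<in>K. dist \<phi> (sample_path T u \<omega> t) \<ge> \<eta> \<longrightarrow>
          objective K \<omega> (sample_path T u \<omega> t, t) + c < objective K \<omega> (\<phi>, t)"
        using c(1) u by (intro exI[of _ c]) (auto simp: sample_path_def)
    qed
  qed
qed

text \<open>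
  The infimum in the hypothesis is over the whole space and hence at most the value at any point of
  \<open>K\<close>, so near-minimality passes to the objective restricted to \<open>K\<close>.
\<close>

lemma near_minimizer_approx_minimizer:
  assumes "\<epsilon> > 0" and un: "\<forall>t\<in>T. un n t \<omega> \<in> K"
    and gap: "(SUP t \<in> T. e2ennreal (ereal (Ln n (un n t \<omega>) t \<omega>) - (INF \<phi>. ereal (Ln n \<phi> t \<omega>))))
      < ennreal \<epsilon>"
  shows "near_minimizer K T (approx_objective K n \<omega>) \<epsilon> (sample_path T (un n) \<omega>)"
  unfolding near_minimizer_def
proof (intro conjI ballI)
  show "sample_path T (un n) \<omega> \<in> T \<rightarrow>\<^sub>E K" using un by (simp add: sample_path_def)
  show "0 \<le> \<epsilon>" using assms(1) by simp
  fix t \<phi> assume t: "t \<in> T" "\<phi> \<in> K"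
  have "e2ennreal (ereal (Ln n (un n t \<omega>) t \<omega> - Ln n \<phi> t \<omega>))
      \<le> e2ennreal (ereal (Ln n (un n t \<omega>) t \<omega>) - (INF \<phi>. ereal (Ln n \<phi> t \<omega>)))"
    unfolding ereal_minus(1)[symmetric]
    by (intro e2ennreal_mono ereal_minus_mono INF_lower) auto
  also have "\<dots> \<le> (SUP t \<in> T. e2ennreal (ereal (Ln n (un n t \<omega>) t \<omega>) - (INF \<phi>. ereal (Ln n \<phi> t \<omega>))))"
    using t(1) by (rule SUP_upper)
  also note gap
  finally have "ennreal (Ln n (un n t \<omega>) t \<omega> - Ln n \<phi> t \<omega>) < ennreal \<epsilon>" by simp
  then have "Ln n (un n t \<omega>) t \<omega> - Ln n \<phi> t \<omega> < \<epsilon>"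
    by (rule contrapos_pp) (simp add: ennreal_leI not_less)
  then show "approx_objective K n \<omega> (sample_path T (un n) \<omega> t, t) \<le> approx_objective K n \<omega> (\<phi>, t) + \<epsilon>"
    using t un by (simp add: sample_path_def)
qed

text \<open>
  The truncation of \<open>\<epsilon>\<close> to values below 1 makes the probability positive, which is what shows that
  the event is measurable: \<^term>\<open>measure M\<close> vanishes on non-measurable sets.
\<close>

lemma minimizer_in_compact_event:
  assumes "\<epsilon> > 0"
  obtains K where "compact K" "{\<omega> \<in> space M. \<forall>t\<in>T. u t \<omega> \<in> K} \<in> sets M"
    "prob {\<omega> \<in> space M. \<forall>t\<in>T. u t \<omega> \<in> K} \<ge> 1 - \<epsilon>"
proof -
  define \<epsilon>' where "\<epsilon>' = min \<epsilon> (1/2)"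
  then obtain K where K: "compact K" "prob {\<omega> \<in> space M. \<forall>t\<in>T. u t \<omega> \<in> K} \<ge> 1 - \<epsilon>'"
    using minimizer_in_compact[of \<epsilon>'] assms by auto
  then have "prob {\<omega> \<in> space M. \<forall>t\<in>T. u t \<omega> \<in> K} \<noteq> 0" by (auto simp: \<epsilon>'_def)
  then show thesis
    using K that[of K] measure_notin_sets by (fastforce simp: \<epsilon>'_def)
qed

text \<open>
  A single null set serves for a sequence of compact sets such that almost every path of the
  minimizer stays in one of them. Since it does not depend on a test function, it can be the
  exceptional set in the construction of a measurable version.
\<close>

lemma minimizer_exhaustion:
  obtains N K where "N \<in> null_sets M" "\<And>m::nat. compact (K m)"
    "\<And>m. {\<omega> \<in> space M. \<forall>t\<in>T. u t \<omega> \<in> K m} \<in> sets M"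
    "\<And>\<omega>. \<omega> \<in> space M - N \<Longrightarrow> \<exists>m. \<forall>t\<in>T. u t \<omega> \<in> K m"
    "\<And>\<omega> m. \<omega> \<in> space M - N \<Longrightarrow> \<forall>t\<in>T. u t \<omega> \<in> K m \<Longrightarrow>
       well_separated_minimizer (K m) T (objective (K m) \<omega>) (sample_path T u \<omega>)"
proof -
  define large where "large m K \<longleftrightarrow> compact K \<and> {\<omega> \<in> space M. \<forall>t\<in>T. u t \<omega> \<in> K} \<in> sets M \<and>
      prob {\<omega> \<in> space M. \<forall>t\<in>T. u t \<omega> \<in> K} \<ge> 1 - 1 / Suc m" for m :: nat and K
  have "\<exists>K. large m K" for m
  proof -
    have "1 / real (Suc m) > 0" by simp
    from minimizer_in_compact_event[OF this] show ?thesis unfolding large_def by blast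
  qed
  then obtain K where "\<And>m. large m (K m)" by metis
  then have K: "\<And>m. compact (K m)" "\<And>m. {\<omega> \<in> space M. \<forall>t\<in>T. u t \<omega> \<in> K m} \<in> sets M"
      "\<And>m. prob {\<omega> \<in> space M. \<forall>t\<in>T. u t \<omega> \<in> K m} \<ge> 1 - 1 / Suc m"
    unfolding large_def by blast+
  define A where "A m = {\<omega> \<in> space M. \<forall>t\<in>T. u t \<omega> \<in> K m}" for m
  have A: "(\<Union>m. A m) \<in> sets M" using K(2) by (auto simp: A_def)
  have "1 \<le> prob (\<Union>m. A m) + e" if "e > 0" for e
  proof -
    obtain m where "1 / Suc m < e" using nat_approx_posE[OF \<open>e > 0\<close>] by blast
    moreover have "prob (A m) \<le> prob (\<Union>m. A m)" using A by (intro finite_measure_mono) auto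
    ultimately show ?thesis using K(3)[of m] by (simp add: A_def)
  qed
  then have "prob (\<Union>m. A m) = 1"
    by (rule antisym[OF prob_le_1 field_le_epsilon])
  then have "AE \<omega> in M. \<omega> \<in> (\<Union>m. A m)"
    using A by (subst (asm) prob_eq_1) auto
  moreover have "AE \<omega> in M. \<forall>m. (\<forall>t\<in>T. u t \<omega> \<in> K m) \<longrightarrow>
      well_separated_minimizer (K m) T (objective (K m) \<omega>) (sample_path T u \<omega>)"
    unfolding AE_all_countable using AE_well_separated_minimizer[OF K(1)] by blast
  ultimately have "AE \<omega> in M. (\<exists>m. \<forall>t\<in>T. u t \<omega> \<in> K m) \<and> (\<forall>m. (\<forall>t\<in>T. u t \<omega> \<in> K m) \<longrightarrow>
      well_separated_minimizer (K m) T (objective (K m) \<omega>) (sample_path T u \<omega>))"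
    by eventually_elim (auto simp: A_def)
  then obtain N where "N \<in> null_sets M"
    "\<And>\<omega>. \<omega> \<in> space M - N \<Longrightarrow> (\<exists>m. \<forall>t\<in>T. u t \<omega> \<in> K m) \<and> (\<forall>m. (\<forall>t\<in>T. u t \<omega> \<in> K m) \<longrightarrow>
      well_separated_minimizer (K m) T (objective (K m) \<omega>) (sample_path T u \<omega>))"
    by (elim AE_E3) auto
  then show thesis using K(1,2) by (intro that[of N K]) blast+
qed

end

section \<open>Weak convergence of the minimizers\<close>

text \<open>
  The last two assumptions say that the space is large enough to contain every function over which
  \<^const>\<open>penalized_sup\<close> maximizes, and that its topology is coarse enough for uniform closeness to
  imply closeness.
\<close>

locale argmin_in_function_space = argmin_processes M T Ln L un u
  for M :: "'w measure" and T :: "'t set"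
    and Ln :: "nat \<Rightarrow> 'a::metric_space \<Rightarrow> 't \<Rightarrow> 'w \<Rightarrow> real"
    and L :: "'a \<Rightarrow> 't \<Rightarrow> 'w \<Rightarrow> real"
    and un :: "nat \<Rightarrow> 't \<Rightarrow> 'w \<Rightarrow> 'a"
    and u :: "'t \<Rightarrow> 'w \<Rightarrow> 'a" +
  fixes D :: "('t \<Rightarrow> 'a) topology"
  assumes metrizable: "metrizable_space D"
    and compact_valued: "\<And>K. compact K \<Longrightarrow> T \<rightarrow>\<^sub>E K \<subseteq> topspace D"
    and uniform_ball: "\<And>U h. openin D U \<Longrightarrow> h \<in> U \<Longrightarrow>
      \<exists>\<eta>>0. \<forall>h'\<in>topspace D. (\<forall>t\<in>T. dist (h' t) (h t) < \<eta>) \<longrightarrow> h' \<in> U"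
begin

context
  fixes f :: "('t \<Rightarrow> 'a) \<Rightarrow> real" and B :: real
  assumes f: "continuous_map D euclideanreal f"
    and f_bound: "\<And>h. h \<in> topspace D \<Longrightarrow> \<bar>f h\<bar> \<le> B" and B_nonneg: "B \<ge> 0"
begin

lemma f_bound_compact: "compact K \<Longrightarrow> h \<in> T \<rightarrow>\<^sub>E K \<Longrightarrow> \<bar>f h\<bar> \<le> B"
  using f_bound compact_valued by blast

lemma f_uniform_upper:
  assumes "h \<in> topspace D" "\<epsilon> > 0"
  shows "\<exists>\<eta>>0. \<forall>h'\<in>topspace D. (\<forall>t\<in>T. dist (h' t) (h t) < \<eta>) \<longrightarrow> f h' \<le> f h + \<epsilon>"
proof -
  have "openin D {x \<in> topspace D. f x \<in> {..< f h + \<epsilon>}}"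
    using f by (rule openin_continuous_map_preimage) simp
  from uniform_ball[OF this, of h] assms show ?thesis
    by (force intro: less_imp_le)
qed

lemma penalized_sup_objective_tendsto:
  assumes K: "compact K" and sep: "well_separated_minimizer K T (objective K \<omega>) h"
  shows "(\<lambda>k. penalized_sup f B K T (real k) (objective K \<omega>)) \<longlonglongrightarrow> f h"
proof (rule penalized_sup_tendsto)
  fix \<epsilon> :: real assume "\<epsilon> > 0"
  have "h \<in> T \<rightarrow>\<^sub>E K" using sep by (simp add: well_separated_minimizer_def)
  then show "\<exists>\<eta>>0. \<forall>h'\<in>T \<rightarrow>\<^sub>E K. (\<forall>t\<in>T. dist (h' t) (h t) < \<eta>) \<longrightarrow> f h' \<le> f h + \<epsilon>"
    using f_uniform_upper[OF _ \<open>\<epsilon> > 0\<close>, of h] compact_valued[OF K] by blast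
qed (use f_bound_compact K sep in auto)

lemma continuous_map_penalized_sup_compact:
  "compact K \<Longrightarrow> continuous_map (linf_topology (K \<times> T)) euclideanreal (penalized_sup f B K T (real k))"
  using f_bound_compact B_nonneg by (intro continuous_map_penalized_sup) auto

lemma abs_penalized_sup_compact_le: "compact K \<Longrightarrow> \<bar>penalized_sup f B K T (real k) g\<bar> \<le> B"
  using f_bound_compact B_nonneg by (intro abs_penalized_sup_le) auto

lemma penalized_sup_objective_measurable:
  assumes "compact K"
  shows "(\<lambda>\<omega>. penalized_sup f B K T (real k) (objective K \<omega>)) \<in> borel_measurable M"
  using weak_conv_objective[OF assms]
  by (intro borel_measurable_comp_continuous_map[OF continuous_map_penalized_sup_compact[OF assms]])
    (simp add: weak_conv_HJ_def)

lemma penalized_sup_approx_objective_tendsto: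
  assumes "compact K"
  shows "(\<lambda>n. outer_expectation M (\<lambda>\<omega>. penalized_sup f B K T (real k) (approx_objective K n \<omega>)))
    \<longlonglongrightarrow> ereal (expectation (\<lambda>\<omega>. penalized_sup f B K T (real k) (objective K \<omega>)))"
proof -
  have "bounded (range (penalized_sup f B K T (real k)))"
    using abs_penalized_sup_compact_le[OF assms] by (auto intro!: boundedI)
  then have "bounded (penalized_sup f B K T (real k) ` topspace (linf_topology (K \<times> T)))"
    by (rule bounded_subset) auto
  then show ?thesis
    using weak_conv_objective[OF assms] continuous_map_penalized_sup_compact[OF assms]
    by (simp add: weak_conv_HJ_def)
qed

end

text \<open>
  On the event that the minimizer takes values in a compact \<open>K\<close>, and outside a null set, a bounded
  continuous function of the minimizer is the limit of penalized suprema of \<open>L\<close> over \<open>K\<close>, which are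
  measurable. Countably many such events cover the rest of the probability space. On the null set a
  constant function is used, which belongs to the space because a one-point set is compact.
\<close>

lemma measurable_minimizer:
  obtains N where "N \<in> null_sets M"
    "sample_path T (\<lambda>t \<omega>. if \<omega> \<in> N then undefined else u t \<omega>) \<in> M \<rightarrow>\<^sub>M borel_sigma D"
proof -
  obtain N K where N: "N \<in> null_sets M" and K: "\<And>m::nat. compact (K m)"
    "\<And>m. {\<omega> \<in> space M. \<forall>t\<in>T. u t \<omega> \<in> K m} \<in> sets M"
    and cover: "\<And>\<omega>. \<omega> \<in> space M - N \<Longrightarrow> \<exists>m. \<forall>t\<in>T. u t \<omega> \<in> K m"
    and sep: "\<And>\<omega> m. \<omega> \<in> space M - N \<Longrightarrow> \<forall>t\<in>T. u t \<omega> \<in> K m \<Longrightarrow>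
       well_separated_minimizer (K m) T (objective (K m) \<omega>) (sample_path T u \<omega>)"
    using minimizer_exhaustion by blast
  define u' where "u' = sample_path T (\<lambda>t \<omega>. if \<omega> \<in> N then undefined else u t \<omega>)"
  have u'_N: "u' \<omega> = (\<lambda>t\<in>T. undefined)" if "\<omega> \<in> N" for \<omega>
    using that by (simp add: u'_def sample_path_def)
  have u'_u: "u' \<omega> = sample_path T u \<omega>" if "\<omega> \<notin> N" for \<omega>
    using that by (simp add: u'_def sample_path_def)
  have in_K: "\<exists>K. compact K \<and> sample_path T u \<omega> \<in> T \<rightarrow>\<^sub>E K" if "\<omega> \<in> space M - N" for \<omega>
    using cover[OF that] K(1) by (auto simp: sample_path_def)
  have "(\<lambda>t\<in>T. undefined) \<in> topspace D"
    using compact_valued[of "{undefined}"] by auto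
  moreover have "sample_path T u \<omega> \<in> topspace D" if "\<omega> \<in> space M - N" for \<omega>
    using in_K[OF that] compact_valued by blast
  ultimately have top: "u' \<in> space M \<rightarrow> topspace D"
    using u'_N u'_u by (intro Pi_I) (metis DiffI)
  have "u' \<in> M \<rightarrow>\<^sub>M borel_sigma D"
  proof (rule measurable_borel_sigma_metrizableI[OF metrizable top])
    fix f assume f: "continuous_map D euclideanreal f" "bounded (f ` topspace D)"
    obtain B where B: "\<And>h. h \<in> topspace D \<Longrightarrow> \<bar>f h\<bar> \<le> B" "B > 0"
      using f(2) unfolding bounded_pos by (auto simp: image_iff)
    \<comment> \<open>Piece 0 is the null set; piece \<open>m + 1\<close> belongs to the \<open>m\<close>-th compact set. The pieces may
      overlap.\<close>
    define A where "A m = (case m of 0 \<Rightarrow> N | Suc m \<Rightarrow> {\<omega> \<in> space M. \<forall>t\<in>T. u t \<omega> \<in> K m} - N)" for m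
    show "(\<lambda>\<omega>. f (u' \<omega>)) \<in> borel_measurable M"
    proof (rule measurable_piecewise_restrict2[of A])
      show "A m \<in> sets M" for m
        using N K(2) by (auto simp: A_def null_setsD2 split: nat.split)
      have "N \<subseteq> space M" using N by (auto dest: null_setsD2 sets.sets_into_space)
      moreover have "\<omega> \<in> (\<Union>m. A m)" if "\<omega> \<in> space M" for \<omega>
      proof (cases "\<omega> \<in> N")
        case True
        then show ?thesis by (intro UN_I[of 0]) (auto simp: A_def)
      next
        case False
        then obtain m where "\<forall>t\<in>T. u t \<omega> \<in> K m" using cover \<open>\<omega> \<in> space M\<close> by blast
        then show ?thesis using that False by (intro UN_I[of "Suc m"]) (auto simp: A_def)
      qed
      ultimately show "space M = (\<Union>m. A m)"
        by (auto simp: A_def split: nat.splits)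
      fix m
      show "\<exists>h\<in>borel_measurable M. \<forall>\<omega>\<in>A m. f (u' \<omega>) = h \<omega>"
      proof (cases m)
        case 0
        then show ?thesis using u'_N by (intro bexI[of _ "\<lambda>_. f (\<lambda>t\<in>T. undefined)"]) (auto simp: A_def)
      next
        case (Suc j)
        let ?F = "\<lambda>k \<omega>. penalized_sup f B (K j) T (real k) (objective (K j) \<omega>)"
        have "(\<lambda>\<omega>. lim (\<lambda>k. ?F k \<omega>)) \<in> borel_measurable M"
          using B K(1) f(1) by (intro borel_measurable_lim_metric penalized_sup_objective_measurable) auto
        moreover have "f (u' \<omega>) = lim (\<lambda>k. ?F k \<omega>)" if "\<omega> \<in> A m" for \<omega>
        proof -
          have \<omega>: "\<omega> \<in> space M - N" "\<forall>t\<in>T. u t \<omega> \<in> K j" using that by (auto simp: A_def Suc)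
          have "(\<lambda>k. ?F k \<omega>) \<longlonglongrightarrow> f (sample_path T u \<omega>)"
            using B \<omega> by (intro penalized_sup_objective_tendsto sep f(1) K(1)) auto
          then show ?thesis using limI u'_u \<omega> by fastforce
        qed
        ultimately show ?thesis by (intro bexI[of _ "\<lambda>\<omega>. lim (\<lambda>k. ?F k \<omega>)"] ballI)
      qed
    qed
  qed
  then show thesis using N unfolding u'_def by (intro that)
qed

text \<open>
  Here \<open>X\<close> stands for the approximate minimizers as points of the function space. It has to agree
  with \<open>un\<close> only where \<open>un\<close> takes values in a compact set, which lets bounded modifications take the
  place of \<open>un\<close>.

  The compact set has to contain the values of both the minimizer and the approximate minimizers
  with high probability. Where one of these containments or the \<open>\<epsilon>\<close>-minimality fails, \<open>f\<close> differs
  from the penalized supremum by at most \<open>2B\<close>, and the probabilities of failure are small.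
\<close>

lemma outer_expectation_minimizers_upper:
  assumes f: "continuous_map D euclideanreal f" "bounded (f ` topspace D)" and "\<delta> > 0"
    and X: "\<And>n \<omega> K. \<omega> \<in> space M \<Longrightarrow> compact K \<Longrightarrow> \<forall>t\<in>T. un n t \<omega> \<in> K \<Longrightarrow> X n \<omega> = sample_path T (un n) \<omega>"
    and X_top: "\<And>n. X n \<in> space M \<rightarrow> topspace D"
    and v: "v \<in> M \<rightarrow>\<^sub>M borel_sigma D" "AE \<omega> in M. v \<omega> = sample_path T u \<omega>"
  shows "\<forall>\<^sub>F n in sequentially. outer_expectation M (\<lambda>\<omega>. f (X n \<omega>)) < ereal (expectation (\<lambda>\<omega>. f (v \<omega>)) + \<delta>)"
proof -
  obtain B where B: "\<And>h. h \<in> topspace D \<Longrightarrow> \<bar>f h\<bar> \<le> B" "B > 0"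
    using f(2) unfolding bounded_pos by (auto simp: image_iff)
  have v_top: "v \<omega> \<in> topspace D" if "\<omega> \<in> space M" for \<omega>
    using measurable_space[OF v(1) that] by simp
  \<comment> \<open>The failure probability allowed for each exceptional event: such an event costs at most \<open>2B\<close>,
    hence \<open>2B\<rho> = \<delta> / 8\<close> in expectation.\<close>
  define \<rho> where "\<rho> = \<delta> / (16 * B)"
  have \<rho>: "\<rho> > 0" "B * \<rho> = \<delta> / 16" using B(2) \<open>\<delta> > 0\<close> by (auto simp: \<rho>_def)
  obtain K1 where K1: "compact K1" "{\<omega> \<in> space M. \<forall>t\<in>T. u t \<omega> \<in> K1} \<in> sets M"
    "prob {\<omega> \<in> space M. \<forall>t\<in>T. u t \<omega> \<in> K1} \<ge> 1 - \<rho>"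
    using minimizer_in_compact_event[OF \<rho>(1)] by blast
  obtain K2 where K2: "compact K2"
    "liminf (\<lambda>n. ereal (inner_prob M {\<omega> \<in> space M. \<forall>t \<in> T. un n t \<omega> \<in> K2})) \<ge> ereal (1 - \<rho> / 2)"
    using approx_minimizers_in_compact[of "\<rho> / 2"] \<rho>(1) by auto
  define K where "K = K1 \<union> K2"
  have K: "compact K" using K1(1) K2(1) by (simp add: K_def compact_Un)
  define A where "A = {\<omega> \<in> space M. \<forall>t\<in>T. u t \<omega> \<in> K1}"
  have A[measurable]: "A \<in> sets M" and prob_A: "prob (space M - A) \<le> \<rho>"
    using K1(2,3) prob_compl[of A] by (auto simp: A_def)
  define F where "F k \<omega> = penalized_sup f B K T (real k) (objective K \<omega>)" for k \<omega>
  have F_meas[measurable]: "F k \<in> borel_measurable M" for k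
    unfolding F_def using B by (intro penalized_sup_objective_measurable f(1) K) auto
  have F_le: "\<bar>F k \<omega>\<bar> \<le> B" for k \<omega>
    unfolding F_def using B by (intro abs_penalized_sup_compact_le f(1) K) auto
  have fv_meas[measurable]: "(\<lambda>\<omega>. f (v \<omega>)) \<in> borel_measurable M"
    using f(1) v(1) by (rule borel_measurable_comp_continuous_map)
  have int_F: "integrable M (F k)" for k
    using F_le by (intro integrable_const_bound[of _ B]) auto
  have int_fv: "integrable M (\<lambda>\<omega>. f (v \<omega>))"
    using B(1) v_top by (intro integrable_const_bound[of _ B]) auto
  \<comment> \<open>The limit \<open>k \<rightarrow> \<infinity>\<close> is known only on \<open>A\<close>; the complement is estimated crudely on both
    sides.\<close>
  have "(\<lambda>k. expectation (\<lambda>\<omega>. indicator A \<omega> * F k \<omega>)) \<longlonglongrightarrow> expectation (\<lambda>\<omega>. indicator A \<omega> * f (v \<omega>))"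
  proof (rule integral_dominated_convergence[where w = "\<lambda>_. B"])
    show "AE \<omega> in M. (\<lambda>k. indicator A \<omega> * F k \<omega>) \<longlonglongrightarrow> indicator A \<omega> * f (v \<omega>)"
      using v(2) AE_well_separated_minimizer[OF K]
    proof eventually_elim
      fix \<omega> assume *: "v \<omega> = sample_path T u \<omega>" "(\<forall>t\<in>T. u t \<omega> \<in> K) \<longrightarrow>
          well_separated_minimizer K T (objective K \<omega>) (sample_path T u \<omega>)"
      show "(\<lambda>k. indicator A \<omega> * F k \<omega>) \<longlonglongrightarrow> indicator A \<omega> * f (v \<omega>)"
      proof (cases "\<omega> \<in> A")
        case True
        then have "well_separated_minimizer K T (objective K \<omega>) (v \<omega>)"
          using * by (auto simp: A_def K_def)
        then have "(\<lambda>k. F k \<omega>) \<longlonglongrightarrow> f (v \<omega>)"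
          unfolding F_def using B by (intro penalized_sup_objective_tendsto f(1) K) auto
        then show ?thesis using True by simp
      qed simp
    qed
    show "AE \<omega> in M. norm (indicator A \<omega> * F k \<omega>) \<le> B" for k
      using F_le B(2) by (intro AE_I2) (auto simp: indicator_def)
  qed auto
  then have "\<forall>\<^sub>F k in sequentially. expectation (\<lambda>\<omega>. indicator A \<omega> * F k \<omega>)
      < expectation (\<lambda>\<omega>. indicator A \<omega> * f (v \<omega>)) + \<delta> / 8"
    using \<open>\<delta> > 0\<close> by (intro order_tendstoD(2)) auto
  then obtain k where k: "expectation (\<lambda>\<omega>. indicator A \<omega> * F k \<omega>)
      < expectation (\<lambda>\<omega>. indicator A \<omega> * f (v \<omega>)) + \<delta> / 8"
    using eventually_happens'[OF sequentially_bot] by blast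
  have int_A: "integrable M (\<lambda>\<omega>. indicator A \<omega> * F k \<omega>)"
    using F_le B(2) by (intro integrable_const_bound[of _ B]) (auto simp: indicator_def)
  have int_Ac: "integrable M (\<lambda>\<omega>. B * indicator (space M - A) \<omega>)"
    by (intro integrable_mult_right integrable_real_indicator) (auto simp: less_top[symmetric])
  have "expectation (F k) \<le> expectation (\<lambda>\<omega>. indicator A \<omega> * F k \<omega> + B * indicator (space M - A) \<omega>)"
  proof (intro integral_mono int_F Bochner_Integration.integrable_add int_A int_Ac)
    show "F k \<omega> \<le> indicator A \<omega> * F k \<omega> + B * indicator (space M - A) \<omega>" if "\<omega> \<in> space M" for \<omega>
      using F_le[of k \<omega>] that by (cases "\<omega> \<in> A") auto
  qed
  also have "\<dots> = expectation (\<lambda>\<omega>. indicator A \<omega> * F k \<omega>) + B * prob (space M - A)"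
    using int_A int_Ac by (subst Bochner_Integration.integral_add) auto
  finally have F1: "expectation (F k) \<le> expectation (\<lambda>\<omega>. indicator A \<omega> * F k \<omega>) + B * prob (space M - A)" .
  have "expectation (\<lambda>\<omega>. indicator A \<omega> * f (v \<omega>)) \<le> expectation (\<lambda>\<omega>. f (v \<omega>) + B * indicator (space M - A) \<omega>)"
  proof (intro integral_mono Bochner_Integration.integrable_add int_fv int_Ac)
    show "integrable M (\<lambda>\<omega>. indicator A \<omega> * f (v \<omega>))"
      using B v_top by (intro integrable_const_bound[of _ B]) (auto simp: indicator_def)
    show "indicator A \<omega> * f (v \<omega>) \<le> f (v \<omega>) + B * indicator (space M - A) \<omega>" if "\<omega> \<in> space M" for \<omega>
      using B(1)[OF v_top[OF that]] that by (cases "\<omega> \<in> A") auto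
  qed
  also have "\<dots> = expectation (\<lambda>\<omega>. f (v \<omega>)) + B * prob (space M - A)"
    using int_fv int_Ac by (subst Bochner_Integration.integral_add) auto
  finally have F2: "expectation (\<lambda>\<omega>. indicator A \<omega> * f (v \<omega>)) \<le> expectation (\<lambda>\<omega>. f (v \<omega>)) + B * prob (space M - A)" .
  have "B * prob (space M - A) \<le> \<delta> / 16"
    using mult_left_mono[OF prob_A, of B] B(2) \<rho>(2) by simp
  with F1 F2 k have EF: "expectation (F k) < expectation (\<lambda>\<omega>. f (v \<omega>)) + \<delta> / 4"
    by linarith

  \<comment> \<open>Now \<open>k\<close> is fixed, so that \<open>\<epsilon>\<close> can be chosen to make the penalty \<open>k\<epsilon>\<close> small.\<close>
  define \<epsilon> where "\<epsilon> = \<delta> / (8 * (real k + 1))"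
  have \<epsilon>: "\<epsilon> > 0" "real k * \<epsilon> \<le> \<delta> / 8"
    using \<open>\<delta> > 0\<close> by (auto simp: \<epsilon>_def field_simps)
  define G where "G n \<omega> = penalized_sup f B K T (real k) (approx_objective K n \<omega>)" for n \<omega>
  define out where "out n = space M - {\<omega> \<in> space M. \<forall>t\<in>T. un n t \<omega> \<in> K2}" for n
  define gap where "gap n = {\<omega> \<in> space M. (SUP t \<in> T. e2ennreal (ereal (Ln n (un n t \<omega>) t \<omega>)
      - (INF \<phi>. ereal (Ln n \<phi> t \<omega>)))) \<ge> ennreal \<epsilon>}" for n
  have "(\<lambda>n. outer_expectation M (G n)) \<longlonglongrightarrow> ereal (expectation (F k))"
    unfolding G_def F_def using B by (intro penalized_sup_approx_objective_tendsto f(1) K) auto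
  then have ev_G: "\<forall>\<^sub>F n in sequentially. outer_expectation M (G n) < ereal (expectation (F k) + \<delta> / 8)"
    using \<open>\<delta> > 0\<close> by (intro order_tendstoD(2)) auto
  have "ereal (1 - \<rho>) < ereal (1 - \<rho> / 2)" using \<rho>(1) by simp
  with K2(2) have "\<forall>\<^sub>F n in sequentially.
      ereal (1 - \<rho>) < ereal (inner_prob M {\<omega> \<in> space M. \<forall>t \<in> T. un n t \<omega> \<in> K2})"
    unfolding le_Liminf_iff by blast
  then have ev_out: "\<forall>\<^sub>F n in sequentially. outer_prob M (out n) < \<rho>"
    by (simp add: inner_prob_def out_def)
  have "(\<lambda>n. outer_prob M (gap n)) \<longlonglongrightarrow> 0"
    using approx_minimizing \<epsilon>(1) unfolding small_o_outer_prob_def gap_def by blast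
  then have ev_gap: "\<forall>\<^sub>F n in sequentially. outer_prob M (gap n) < \<rho>"
    using \<rho>(1) by (rule order_tendstoD(2))
  show ?thesis
    using ev_G ev_out ev_gap
  proof eventually_elim
    fix n
    assume G: "outer_expectation M (G n) < ereal (expectation (F k) + \<delta> / 8)"
      and out: "outer_prob M (out n) < \<rho>" and gap: "outer_prob M (gap n) < \<rho>"
    \<comment> \<open>Measurable covers of the two exceptional events, which need not be measurable.\<close>
    obtain B1 where B1[measurable]: "B1 \<in> sets M" and B1': "out n \<subseteq> B1" "prob B1 < \<rho>"
      using outer_prob_lessD[OF _ out] by (auto simp: out_def)
    obtain B2 where B2[measurable]: "B2 \<in> sets M" and B2': "gap n \<subseteq> B2" "prob B2 < \<rho>"
      using outer_prob_lessD[OF _ gap] by (auto simp: gap_def)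
    define W where "W \<omega> = real k * \<epsilon> + 2 * B * indicator B1 \<omega> + 2 * B * indicator B2 \<omega>" for \<omega>
    have ind: "integrable M (indicator B1 :: 'w \<Rightarrow> real)" "integrable M (indicator B2 :: 'w \<Rightarrow> real)"
      by (auto intro!: integrable_real_indicator simp: less_top[symmetric])
    then have int_W: "integrable M W"
      unfolding W_def by (intro Bochner_Integration.integrable_add integrable_mult_right integrable_const)
    have EW: "expectation W = real k * \<epsilon> + 2 * B * prob B1 + 2 * B * prob B2"
      unfolding W_def using ind by (simp add: prob_space)
    have "f (X n \<omega>) \<le> G n \<omega> + W \<omega>" if \<omega>: "\<omega> \<in> space M" for \<omega>
    proof (cases "\<omega> \<in> B1 \<union> B2")
      case True
      have "\<bar>f (X n \<omega>)\<bar> \<le> B" using B(1) X_top \<omega> by blast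
      moreover have "\<bar>G n \<omega>\<bar> \<le> B"
        unfolding G_def using B by (intro abs_penalized_sup_compact_le f(1) K) auto
      moreover have "2 * B \<le> W \<omega>"
        using True B(2) \<epsilon>(1) by (auto simp: W_def indicator_def)
      ultimately show ?thesis by linarith
    next
      case False
      then have "\<omega> \<notin> out n" "\<omega> \<notin> gap n" using B1' B2' by auto
      then have un: "\<forall>t\<in>T. un n t \<omega> \<in> K" and g: "(SUP t \<in> T. e2ennreal (ereal (Ln n (un n t \<omega>) t \<omega>)
          - (INF \<phi>. ereal (Ln n \<phi> t \<omega>)))) < ennreal \<epsilon>"
        using \<omega> by (auto simp: out_def gap_def K_def not_le)
      have "f (sample_path T (un n) \<omega>) - real k * \<epsilon> \<le> G n \<omega>"
        unfolding G_def using f_bound_compact[OF f(1) _ _ K] B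
        by (intro penalized_sup_upper near_minimizer_approx_minimizer[OF \<epsilon>(1) un g]) auto
      moreover have "X n \<omega> = sample_path T (un n) \<omega>" using X[OF \<omega> K un] .
      moreover have "real k * \<epsilon> \<le> W \<omega>" using B(2) by (auto simp: W_def indicator_def)
      ultimately show ?thesis by simp
    qed
    then have "outer_expectation M (\<lambda>\<omega>. f (X n \<omega>)) \<le> outer_expectation M (G n) + ereal (expectation W)"
      by (rule outer_expectation_le_add_integral[OF int_W])
    also have "\<dots> < ereal (expectation (F k) + \<delta> / 8) + ereal (expectation W)"
      using G by (cases "outer_expectation M (G n)") auto
    also have "\<dots> \<le> ereal (expectation (\<lambda>\<omega>. f (v \<omega>)) + \<delta>)"
    proof -
      have "B * prob B1 \<le> \<delta> / 16" "B * prob B2 \<le> \<delta> / 16"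
        unfolding \<rho>(2)[symmetric] using B1'(2) B2'(2) B(2) by (auto intro: mult_left_mono)
      then show ?thesis using EF EW \<epsilon>(2) \<open>\<delta> > 0\<close> by simp
    qed
    finally show "outer_expectation M (\<lambda>\<omega>. f (X n \<omega>)) < ereal (expectation (\<lambda>\<omega>. f (v \<omega>)) + \<delta>)" .
  qed
qed

theorem weak_conv_minimizers:
  obtains u' where "is_version M T u' u"
    "\<And>X. (\<And>n. X n \<in> space M \<rightarrow> topspace D) \<Longrightarrow>
       (\<And>n \<omega> K. \<omega> \<in> space M \<Longrightarrow> compact K \<Longrightarrow> \<forall>t\<in>T. un n t \<omega> \<in> K \<Longrightarrow> X n \<omega> = sample_path T (un n) \<omega>) \<Longrightarrow>
       weak_conv_HJ M D X (sample_path T u')"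
proof -
  obtain N where N: "N \<in> null_sets M"
    "sample_path T (\<lambda>t \<omega>. if \<omega> \<in> N then undefined else u t \<omega>) \<in> M \<rightarrow>\<^sub>M borel_sigma D"
    by (rule measurable_minimizer)
  define u' where "u' = (\<lambda>t \<omega>. if \<omega> \<in> N then undefined else u t \<omega>)"
  have AE: "AE \<omega> in M. \<forall>t. u' t \<omega> = u t \<omega>"
    using AE_not_in[OF N(1)] by eventually_elim (simp add: u'_def)
  then have "is_version M T u' u"
    unfolding is_version_def by (auto elim!: eventually_mono)
  moreover have "AE \<omega> in M. sample_path T u' \<omega> = sample_path T u \<omega>"
    using AE by eventually_elim (simp add: sample_path_def)
  ultimately show thesis
    using N(2)[folded u'_def]
    by (intro that[of u'] weak_conv_HJI outer_expectation_minimizers_upper) assumption+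
qed

end

theorem theorem3:
  fixes M :: "'w measure"
  shows
    "(\<forall>(T :: 't set) (Ln :: nat \<Rightarrow> 'a::metric_space \<Rightarrow> 't \<Rightarrow> 'w \<Rightarrow> real) L un u.
        finite T \<and> argmin_processes M T Ln L un u \<longrightarrow>
        (\<exists>u'. is_version M T u' u \<and>
              weak_conv_HJ M (product_topology (\<lambda>_. euclidean) T)
                (\<lambda>n. sample_path T (un n)) (sample_path T u')))
   \<and> (\<forall>(T :: 't set) (Ln :: nat \<Rightarrow> real^'p \<Rightarrow> 't \<Rightarrow> 'w \<Rightarrow> real) L un u.
        argmin_processes M T Ln L un u \<longrightarrow>
        (\<exists>u'. is_version M T u' u \<and>
              (\<forall>vn. (\<forall>n. bounded_modification M T (vn n) (un n)) \<longrightarrow>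
                    weak_conv_HJ M (linf_topology T)
                      (\<lambda>n. sample_path T (vn n)) (sample_path T u'))))"
proof (intro conjI allI impI; (elim conjE)?)
  fix T :: "'t set" and Ln :: "nat \<Rightarrow> 'a \<Rightarrow> 't \<Rightarrow> 'w \<Rightarrow> real" and L un u
  assume "finite T" and argmin: "argmin_processes M T Ln L un u"
  let ?D = "product_topology (\<lambda>_. euclidean) T :: ('t \<Rightarrow> 'a) topology"
  interpret argmin_in_function_space M T Ln L un u ?D
  proof (intro argmin_in_function_space.intro argmin argmin_in_function_space_axioms.intro)
    show "metrizable_space ?D"
      using \<open>finite T\<close> unfolding metrizable_space_product_topology
      by (auto simp: metrizable_space_euclidean intro: countable_finite)
    show "T \<rightarrow>\<^sub>E K \<subseteq> topspace ?D" for K :: "'a set" by auto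
    show "\<exists>\<eta>>0. \<forall>h'\<in>topspace ?D. (\<forall>t\<in>T. dist (h' t) (h t) < \<eta>) \<longrightarrow> h' \<in> U"
      if "openin ?D U" "h \<in> U" for U h
      using openin_product_euclidean_contains_uniform_ball[OF \<open>finite T\<close> that] by simp
  qed
  obtain u' where "is_version M T u' u" "weak_conv_HJ M ?D (\<lambda>n. sample_path T (un n)) (sample_path T u')"
    using weak_conv_minimizers[of thesis] by (auto simp: sample_path_def)
  then show "\<exists>u'. is_version M T u' u \<and> weak_conv_HJ M ?D (\<lambda>n. sample_path T (un n)) (sample_path T u')"
    by blast
next
  fix T :: "'t set" and Ln :: "nat \<Rightarrow> real^'p \<Rightarrow> 't \<Rightarrow> 'w \<Rightarrow> real" and L un u
  assume argmin: "argmin_processes M T Ln L un u"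
  let ?D = "linf_topology T :: ('t \<Rightarrow> real^'p) topology"
  interpret argmin_in_function_space M T Ln L un u ?D
  proof (intro argmin_in_function_space.intro argmin argmin_in_function_space_axioms.intro)
    show "metrizable_space ?D" by (rule metrizable_space_linf_topology)
    show "T \<rightarrow>\<^sub>E K \<subseteq> topspace ?D" if "compact K" for K
      using bounded_subset[OF compact_imp_bounded[OF that]]
      by (auto simp: topspace_linf_topology PiE_iff image_subset_iff)
    show "\<exists>\<eta>>0. \<forall>h'\<in>topspace ?D. (\<forall>t\<in>T. dist (h' t) (h t) < \<eta>) \<longrightarrow> h' \<in> U"
      if "openin ?D U" "h \<in> U" for U h
      using that by (rule openin_linf_topology_contains_uniform_ball)
  qed
  obtain u' where u': "is_version M T u' u"
    "\<And>X. (\<And>n. X n \<in> space M \<rightarrow> topspace ?D) \<Longrightarrow>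
       (\<And>n \<omega> K. \<omega> \<in> space M \<Longrightarrow> compact K \<Longrightarrow> \<forall>t\<in>T. un n t \<omega> \<in> K \<Longrightarrow> X n \<omega> = sample_path T (un n) \<omega>) \<Longrightarrow>
       weak_conv_HJ M ?D X (sample_path T u')"
    using weak_conv_minimizers by blast
  have "weak_conv_HJ M ?D (\<lambda>n. sample_path T (vn n)) (sample_path T u')"
    if vn: "\<forall>n. bounded_modification M T (vn n) (un n)" for vn
  proof (rule u'(2))
    show "sample_path T (vn n) \<in> space M \<rightarrow> topspace ?D" for n
      using vn by (auto simp: bounded_modification_def topspace_linf_topology sample_path_def)
    fix n \<omega> and K :: "(real^'p) set"
    assume "\<omega> \<in> space M" "compact K" "\<forall>t\<in>T. un n t \<omega> \<in> K"
    then have "bounded ((\<lambda>t. un n t \<omega>) ` T)"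
      by (auto intro: bounded_subset[OF compact_imp_bounded])
    then have "\<forall>t\<in>T. vn n t \<omega> = un n t \<omega>"
      using vn \<open>\<omega> \<in> space M\<close> by (auto simp: bounded_modification_def)
    then show "sample_path T (vn n) \<omega> = sample_path T (un n) \<omega>"
      by (auto simp: sample_path_def)
  qed
  then show "\<exists>u'. is_version M T u' u \<and> (\<forall>vn. (\<forall>n. bounded_modification M T (vn n) (un n)) \<longrightarrow>
      weak_conv_HJ M ?D (\<lambda>n. sample_path T (vn n)) (sample_path T u'))"
    using u'(1) by blast
qed

end
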